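(* Let $\mathbb{Q}$ be the law of a translation-invariant, finite-range self-interacting random walk on $\mathbb{Z}^d$ started at the origin, with expansion coefficients $\{\pi_m\}_{m\ge2}$ as defined in the context. If $\lim_{n\to\infty}\sum_{m=2}^n\sum_x x\,\pi_m(x)$ exists and $n^{-1}\omega_n\to\theta$ in probability under $\mathbb{Q}$ for some $\theta\in\mathbb{R}^d$, then $$\theta=\sum_x x\,p^{o}(o,x)+\sum_{m=2}^\infty\sum_x x\,\pi_m(x).$$
   Context: Self-interacting random walk. A finite path is $\vec{x}_i=(x_0,\dots,x_i)$ with $x_j\in\mathbb{Z}^d$. For every finite path $\vec{x}_i$ a probability mass function $y\mapsto p^{\vec{x}_i}(x_i,y)$ on $\mathbb{Z}^d$ is given (the conditional probability of stepping from $x_i$ to $y$ given the history $\vec{x}_i$). It is translation invariant, i.e. unchanged when the whole path and $y$ are shifted by the same vector, and has finite range $L<\infty$, i.e. $p^{\vec{x}_i}(x_i,y)=0$ if $|y-x_i|>L$. The walk $\vec\omega=(\omega_0,\omega_1,\dots)$ started at the origin $o$ has law $\mathbb{Q}$ given by $\mathbb{Q}(\vec\omega_n=(x_0,\dots,x_n))=\prod_{i=0}^{n-1}p^{\vec{x}_i}(x_i,x_{i+1})$ for $x_0=o$, where $\vec\omega_n=(\omega_0,\dots,\omega_n)$. Write $D(x)=p^{o}(o,x)=\mathbb{Q}(\omega_1=x)$. Concatenation. If $\vec\eta_j=(\eta_0,\dots,\eta_j)$ and $\vec{x}_m=(x_0,\dots,x_m)$ with $\eta_j=x_0$, then $\vec\eta_j\circ\vec{x}_m=(\eta_0,\dots,\eta_j,x_1,\dots,x_m)$.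 Expansion coefficients. For $N\ge1$ and $m\ge 2$ let $\mathcal{A}_{m,N}=\{(j_1,\dots,j_N)\in\mathbb{Z}_{\ge0}^N: j_1+\dots+j_N=m-N-1\}$ and set $j_0=0$. For $\vec{j}\in\mathcal{A}_{m,N}$ consider paths $\vec\omega^{(0)}_1=(o,\omega^{(0)}_1)$ and, for $n=1,\dots,N$, $\vec\omega^{(n)}_{j_n+1}=(\omega^{(n)}_0,\dots,\omega^{(n)}_{j_n+1})$ with $\omega^{(n)}_0=\omega^{(n-1)}_{j_{n-1}+1}$; $\vec\omega^{(n)}_i$ denotes the first $i$ steps of $\vec\omega^{(n)}_{j_n+1}$. Put $$\Delta^{(n)}_{j_n+1}=\Big(p^{\vec\omega^{(n-1)}_{j_{n-1}+1}\circ\vec\omega^{(n)}_{j_n}}-p^{\vec\omega^{(n)}_{j_n}}\Big)\big(\omega^{(n)}_{j_n},\omega^{(n)}_{j_n+1}\big),$$ $$\pi_m^{(N)}(y)=\sum_{\vec{j}\in\mathcal{A}_{m,N}}\ \sum_{\vec\omega^{(0)}_1}\sum_{\vec\omega^{(1)}_{j_1+1}}\cdots\sum_{\vec\omega^{(N)}_{j_N+1}} I_{\{\omega^{(N)}_{j_N+1}=y\}}\,D(\omega^{(0)}_1)\prod_{n=1}^N\Delta^{(n)}_{j_n+1}\prod_{i=0}^{j_n-1}p^{\vec\omega^{(n-1)}_{j_{n-1}+1}\circ\vec\omega^{(n)}_{i}}\big(\omega^{(n)}_i,\omega^{(n)}_{i+1}\big),$$ the sums being over all such paths and empty products being $1$.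 Finally $\pi_m(y)=\sum_{N=1}^\infty\pi_m^{(N)}(y)$ (the terms with $N+1>m$ vanish). *)

theory Defs
  imports "HOL-Probability.Probability"
begin

type_synonym 'd site = "int ^ 'd"

text \<open>A finite path \<open>(x\<^sub>0, \<dots>, x\<^sub>i)\<close> is the nonempty list \<open>[x\<^sub>0, \<dots>, x\<^sub>i]\<close>; it has
  \<open>i\<close> steps and length \<open>i + 1\<close>.\<close>

type_synonym 'd path = "'d site list"

text \<open>\<open>pmf (p xs) y\<close> is the probability of stepping from \<open>last xs\<close> to \<open>y\<close> given the history
  \<open>xs\<close>. The value of \<open>p\<close> at the empty list is irrelevant.\<close>

type_synonym 'd kernel = "'d path \<Rightarrow> 'd site pmf"

definition rvec :: "'d::finite site \<Rightarrow> real ^ 'd" where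
  "rvec x = (\<chi> i. real_of_int (x $ i))"

definition translation_invariant :: "'d::finite kernel \<Rightarrow> bool" where
  "translation_invariant p \<longleftrightarrow>
     (\<forall>xs v y. xs \<noteq> [] \<longrightarrow> pmf (p (map (\<lambda>x. x + v) xs)) (y + v) = pmf (p xs) y)"

definition finite_range :: "'d::finite kernel \<Rightarrow> real \<Rightarrow> bool" where
  "finite_range p L \<longleftrightarrow>
     (\<forall>xs y. xs \<noteq> [] \<longrightarrow> norm (rvec (y - last xs)) > L \<longrightarrow> pmf (p xs) y = 0)"

text \<open>\<open>Q\<close> is the law of the walk started at the origin. The cylinder probabilities
  determine \<open>Q\<close> uniquely; for \<open>n = 0\<close> they give \<open>\<omega>\<^sub>0 = 0\<close> almost surely.\<close>

definition walk_law :: "'d::finite kernel \<Rightarrow> (nat \<Rightarrow> 'd site) measure \<Rightarrow> bool" where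
  "walk_law p Q \<longleftrightarrow>
     prob_space Q \<and>
     sets Q = sets (PiM UNIV (\<lambda>_::nat. count_space (UNIV :: 'd site set))) \<and>
     (\<forall>n x. x 0 = 0 \<longrightarrow>
        measure Q {\<omega> \<in> space Q. \<forall>i\<le>n. \<omega> i = x i} =
        (\<Prod>i<n. pmf (p (map x [0..<Suc i])) (x (Suc i))))"

definition tendsto_in_probability ::
    "'a measure \<Rightarrow> (nat \<Rightarrow> 'a \<Rightarrow> 'b::real_normed_vector) \<Rightarrow> 'b \<Rightarrow> bool" where
  "tendsto_in_probability M X c \<longleftrightarrow>
     (\<forall>\<epsilon>>0. (\<lambda>n. measure M {\<omega> \<in> space M. norm (X n \<omega> - c) > \<epsilon>}) \<longlonglongrightarrow> 0)"

text \<open>The one-step distribution \<open>D\<close> from the origin.\<close>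

definition step_prob :: "'d::finite kernel \<Rightarrow> 'd site \<Rightarrow> real" where
  "step_prob p x = pmf (p [0]) x"

definition path_concat :: "'d path \<Rightarrow> 'd path \<Rightarrow> 'd path"  (infixr "\<circ>\<^sub>p" 65) where
  "\<eta> \<circ>\<^sub>p xs = \<eta> @ tl xs"

text \<open>The index set \<open>\<A>\<^bsub>m,N\<^esub>\<close>. Tuples are functions that vanish outside \<open>{1..N}\<close>, which
  includes the convention \<open>j\<^sub>0 = 0\<close>. The equation is \<open>j\<^sub>1 + \<dots> + j\<^sub>N = m - N - 1\<close> without
  truncated subtraction.\<close>

definition lace_indices :: "nat \<Rightarrow> nat \<Rightarrow> (nat \<Rightarrow> nat) set" where
  "lace_indices m N =
     {j. (\<forall>n. n \<notin> {1..N} \<longrightarrow> j n = 0) \<and> (\<Sum>n=1..N. j n) + N + 1 = m}"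

text \<open>Families \<open>W 0, \<dots>, W N\<close> of paths, \<open>W n\<close> having \<open>j n + 1\<close> steps, each starting where the
  previous one ends. Entries beyond \<open>N\<close> are fixed to \<open>[]\<close> so that each tuple is represented
  by exactly one function.\<close>

definition lace_paths :: "(nat \<Rightarrow> nat) \<Rightarrow> nat \<Rightarrow> (nat \<Rightarrow> 'd::finite path) set" where
  "lace_paths j N =
     {W. (\<forall>n\<le>N. length (W n) = j n + 2) \<and> hd (W 0) = 0 \<and>
         (\<forall>n\<in>{1..N}. hd (W n) = last (W (n - 1))) \<and> (\<forall>n>N. W n = [])}"

text \<open>\<open>take (i + 1) (W n)\<close> is the initial part of \<open>W n\<close> with \<open>i\<close> steps.\<close>

definition lace_\<Delta> ::
    "'d::finite kernel \<Rightarrow> (nat \<Rightarrow> nat) \<Rightarrow> (nat \<Rightarrow> 'd path) \<Rightarrow> nat \<Rightarrow> real" where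
  "lace_\<Delta> p j W n =
     pmf (p (W (n - 1) \<circ>\<^sub>p take (j n + 1) (W n))) (W n ! (j n + 1))
     - pmf (p (take (j n + 1) (W n))) (W n ! (j n + 1))"

definition lace_weight ::
    "'d::finite kernel \<Rightarrow> (nat \<Rightarrow> nat) \<Rightarrow> nat \<Rightarrow> (nat \<Rightarrow> 'd path) \<Rightarrow> real" where
  "lace_weight p j N W =
     step_prob p (W 0 ! 1) *
     (\<Prod>n=1..N. lace_\<Delta> p j W n *
        (\<Prod>i<j n. pmf (p (W (n - 1) \<circ>\<^sub>p take (i + 1) (W n))) (W n ! (i + 1))))"

text \<open>For a kernel of finite range, only finitely many terms of the following infinite sums
  are nonzero.\<close>

definition lace_piN :: "'d::finite kernel \<Rightarrow> nat \<Rightarrow> nat \<Rightarrow> 'd site \<Rightarrow> real" where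
  "lace_piN p m N y =
     (\<Sum>j\<in>lace_indices m N. \<Sum>\<^sub>\<infinity>W\<in>lace_paths j N.
        of_bool (last (W N) = y) * lace_weight p j N W)"

definition lace_pi :: "'d::finite kernel \<Rightarrow> nat \<Rightarrow> 'd site \<Rightarrow> real" where
  "lace_pi p m y = (\<Sum>\<^sub>\<infinity>N\<in>{1..}. lace_piN p m N y)"

definition first_moment :: "('d::finite site \<Rightarrow> real) \<Rightarrow> real ^ 'd" where
  "first_moment f = (\<Sum>\<^sub>\<infinity>x. f x *\<^sub>R rvec x)"

end

theory Submission
  imports Defs
begin

text \<open>Let \<open>a\<^sub>n\<close> be the expected position of the walk after \<open>n\<close> steps. The proof computes the limit
  of \<open>a\<^sub>n / n\<close> in two ways. Since the steps are bounded, \<open>\<omega>\<^sub>n / n\<close> is bounded, so its convergence in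
  probability to \<open>\<theta>\<close> gives \<open>a\<^sub>n / n \<longlonglongrightarrow> \<theta>\<close> (\<open>mean_pos_over_n_tendsto\<close>). On the other hand the
  lace expansion gives \<open>a\<^sub>n\<^sub>+\<^sub>1 - a\<^sub>n = \<Sum>\<^sub>x x D(x) + \<Sum>\<^sub>2\<^sub>\<le>\<^sub>m\<^sub>\<le>\<^sub>n\<^sub>+\<^sub>1 \<Sum>\<^sub>x x \<pi>\<^sub>m(x)\<close> (\<open>mean_pos_increment\<close>);
  the right-hand side converges by hypothesis, and the Cesaro means \<open>a\<^sub>n / n\<close> of the increments
  have the same limit.

  The increment formula is obtained for expectations directly, without the two-point functions.
  Let \<open>mean_pos n h\<close> be the expected position \<open>n\<close> steps after the history \<open>h\<close>, and let
  \<open>memory n h = mean_pos n h - mean_pos n [last h]\<close> be the effect of the part of \<open>h\<close> before its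
  last site. Replacing the walk that remembers \<open>h\<close> by the walk that forgets it, one step at a
  time, produces one factor \<open>\<Delta>\<close> at the step where the replacement happens; after that step the
  walk starts afresh with a history that has just been walked, and its expected position is again
  a forgetful expectation plus a memory term. By translation invariance the forgetful expectation
  is the present position plus a constant, and the constant disappears because \<open>\<Delta>\<close> sums to \<open>0\<close>
  over its last step (\<open>memory_expand\<close>). Iterating this recursion \<open>N\<close> times produces exactly the
  weights of \<open>\<pi>\<^sup>(\<^sup>N\<^sup>)\<close> (\<open>memory_lace_step\<close>). The iteration stops, since each round uses up at least
  one step. The starting point is the walk after its first step, with history \<open>(0, \<omega>\<^sub>1)\<close>.

  Finite range makes all of this finite: the weights are supported on the finite sets
  \<open>bounded_paths\<close> and \<open>bounded_lace_paths\<close>, so that every infinite sum is a finite one.\<close>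

section \<open>Paths with bounded steps\<close>

text \<open>The symbol is used for concatenation of paths here, not for composition of polynomials.\<close>

no_notation pcompose (infixl "\<circ>\<^sub>p" 71)

definition steps :: "real \<Rightarrow> 'd::finite site set" where
  "steps L = {v. norm (rvec v) \<le> L}"

text \<open>The recursion appends the last step, because the lace weights are products in which the last
  step of a path carries the distinguished factor. The index counts steps, not sites.\<close>

primrec bounded_paths :: "real \<Rightarrow> 'd::finite site \<Rightarrow> nat \<Rightarrow> 'd path set" where
  "bounded_paths L a 0 = {[a]}"
| "bounded_paths L a (Suc k) =
     (\<lambda>(x, v). x @ [last x + v]) ` (bounded_paths L a k \<times> steps L)"

lemma rvec_add: "rvec (x + y) = rvec x + rvec y"
  by (simp add: rvec_def vec_eq_iff)

lemma finite_steps: "finite (steps L :: 'd::finite site set)"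
proof -
  have "finite {k::int. real_of_int \<bar>k\<bar> \<le> \<bar>L\<bar>}"
    by (rule finite_subset[of _ "{- \<lfloor>\<bar>L\<bar>\<rfloor>..\<lfloor>\<bar>L\<bar>\<rfloor>}"]) (auto simp: le_floor_iff abs_le_iff minus_le_iff)
  moreover have "finite {f :: 'd \<Rightarrow> int. \<forall>i. f i \<in> K}" if "finite K" for K
    using finite_set_of_finite_funs[OF finite[of "UNIV :: 'd set"] that] by simp
  ultimately have fin: "finite {f :: 'd \<Rightarrow> int. \<forall>i. f i \<in> {k. real_of_int \<bar>k\<bar> \<le> \<bar>L\<bar>}}"
    by blast
  have "vec_nth ` (steps L :: 'd site set) \<subseteq> {f. \<forall>i. f i \<in> {k. real_of_int \<bar>k\<bar> \<le> \<bar>L\<bar>}}"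
  proof clarsimp
    fix v :: "'d site" and i
    assume "v \<in> steps L"
    moreover have "\<bar>rvec v $ i\<bar> \<le> norm (rvec v)" by (rule component_le_norm_cart)
    ultimately show "\<bar>real_of_int (v $ i)\<bar> \<le> \<bar>L\<bar>" by (simp add: steps_def rvec_def)
  qed
  with fin have "finite (vec_nth ` (steps L :: 'd site set))" by (rule finite_subset[rotated])
  then show ?thesis by (rule finite_imageD) (auto simp: inj_on_def vec_nth_inject)
qed

lemma bounded_paths_1: "bounded_paths L a (Suc 0) = (\<lambda>v. [a, a + v]) ` steps L"
  by (auto simp: image_iff)

lemma finite_bounded_paths: "finite (bounded_paths L a k)"
  by (induction k) (simp_all add: finite_steps)

lemma bounded_paths_props:
  assumes "x \<in> bounded_paths L a k"
  shows "length x = Suc k" "hd x = a" "x \<noteq> []"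
proof -
  have "length x = Suc k \<and> hd x = a" using assms
    by (induction k arbitrary: x) (fastforce simp: hd_append)+
  then show "length x = Suc k" "hd x = a" "x \<noteq> []" by auto
qed

lemma sum_bounded_paths_Suc:
  fixes f :: "'d::finite path \<Rightarrow> 'b::comm_monoid_add"
  shows "(\<Sum>x\<in>bounded_paths L a (Suc k). f x) =
         (\<Sum>x\<in>bounded_paths L a k. \<Sum>v\<in>steps L. f (x @ [last x + v]))"
proof -
  have "inj_on (\<lambda>(x, v). x @ [last x + v]) (bounded_paths L a k \<times> (steps L :: 'd site set))"
    by (auto simp: inj_on_def)
  then show ?thesis
    by (simp add: sum.reindex sum.cartesian_product case_prod_unfold)
qed

text \<open>This is how weights are seen to vanish off \<open>bounded_paths\<close>: a path outside makes a step that
  the walk cannot make.\<close>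

lemma long_step_if_not_bounded_path:
  assumes "length x = Suc k" "x \<notin> bounded_paths L (hd x) k"
  shows "\<exists>i<k. norm (rvec (x ! Suc i - x ! i)) > L"
  using assms
proof (induction k arbitrary: x)
  case 0
  then show ?case by (cases x) auto
next
  case (Suc k)
  then obtain z y where x: "x = z @ [y]" and z: "length z = Suc k"
    by (metis length_Suc_conv_rev)
  have hd: "hd x = hd z" using x z by (cases z) auto
  show ?case
  proof (cases "z \<in> bounded_paths L (hd z) k")
    case True
    have "y - last z \<notin> steps L"
    proof
      assume "y - last z \<in> steps L"
      then have "z @ [y] \<in> bounded_paths L (hd z) (Suc k)"
        unfolding bounded_paths.simps
        by (intro image_eqI[where x = "(z, y - last z)"]) (use True in auto)
      with Suc.prems show False by (simp add: x hd[unfolded x])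
    qed
    moreover have "last z = x ! k" using x z by (cases z rule: rev_cases) (auto simp: nth_append)
    moreover have "y = x ! Suc k" using x z by (simp add: nth_append)
    ultimately show ?thesis by (auto simp: steps_def intro!: exI[of _ k])
  next
    case False
    from Suc.IH[OF z this] obtain i where "i < k" "norm (rvec (z ! Suc i - z ! i)) > L" by auto
    then show ?thesis using x z by (auto simp: nth_append intro!: exI[of _ i])
  qed
qed

lemma norm_last_bounded_path_le:
  assumes "x \<in> bounded_paths L a k"
  shows "norm (rvec (last x) - rvec a) \<le> real k * L"
  using assms
proof (induction k arbitrary: x)
  case 0
  then show ?case by simp
next
  case (Suc k)
  then obtain z v where z: "z \<in> bounded_paths L a k" and v: "v \<in> steps L"
    and x: "x = z @ [last z + v]" by auto
  have "norm (rvec (last x) - rvec a) \<le> norm (rvec (last z) - rvec a) + norm (rvec v)"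
    using norm_triangle_ineq[of "rvec (last z) - rvec a" "rvec v"]
    by (simp add: x rvec_add algebra_simps)
  with Suc.IH[OF z] v show ?case by (simp add: steps_def algebra_simps)
qed

declare bounded_paths.simps(2) [simp del]

section \<open>Weights of paths with a history\<close>

lemma path_concat_append: "x \<noteq> [] \<Longrightarrow> h \<circ>\<^sub>p (x @ [y]) = (h \<circ>\<^sub>p x) @ [y]"
  by (simp add: path_concat_def)

lemma path_concat_last_eq: "h \<circ>\<^sub>p [last h] = h"
  by (simp add: path_concat_def)

lemma last_path_concat:
  assumes "x \<noteq> []" "last h = hd x"
  shows "last (h \<circ>\<^sub>p x) = last x"
  using assms by (cases x) (auto simp: path_concat_def)

lemma path_concat_nonempty: "h \<noteq> [] \<Longrightarrow> h \<circ>\<^sub>p x \<noteq> []"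
  by (simp add: path_concat_def)

text \<open>\<open>hist_weight p h k x\<close> is the probability that the walk with history \<open>h\<close> follows the first
  \<open>k\<close> steps of a path \<open>x\<close> that starts at \<open>last h\<close>. \<open>lace_factor p h k x\<close> is the factor that one path of \<open>k + 1\<close> steps contributes
  to a lace weight: \<open>k\<close> steps with memory of \<open>h\<close>, followed by the difference \<open>\<Delta>\<close>.\<close>

definition hist_weight :: "'d::finite kernel \<Rightarrow> 'd path \<Rightarrow> nat \<Rightarrow> 'd path \<Rightarrow> real" where
  "hist_weight p h k x = (\<Prod>i<k. pmf (p (h \<circ>\<^sub>p take (i + 1) x)) (x ! (i + 1)))"

definition lace_factor :: "'d::finite kernel \<Rightarrow> 'd path \<Rightarrow> nat \<Rightarrow> 'd path \<Rightarrow> real" where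
  "lace_factor p h k x =
     (pmf (p (h \<circ>\<^sub>p take (k + 1) x)) (x ! (k + 1)) - pmf (p (take (k + 1) x)) (x ! (k + 1)))
     * hist_weight p h k x"

lemma hist_weight_0: "hist_weight p h 0 x = 1"
  by (simp add: hist_weight_def)

lemma hist_weight_append:
  assumes "length x = Suc k"
  shows "hist_weight p h k (x @ [y]) = hist_weight p h k x"
  unfolding hist_weight_def using assms by (intro prod.cong) (auto simp: nth_append)

lemma hist_weight_Suc:
  assumes "length x = Suc k"
  shows "hist_weight p h (Suc k) (x @ [y]) = hist_weight p h k x * pmf (p (h \<circ>\<^sub>p x)) y"
proof -
  have "hist_weight p h (Suc k) (x @ [y])
      = hist_weight p h k (x @ [y]) * pmf (p (h \<circ>\<^sub>p x)) y"
    using assms by (simp add: hist_weight_def nth_append)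
  then show ?thesis by (simp add: hist_weight_append assms)
qed

lemma lace_factor_append:
  assumes "length x = Suc k"
  shows "lace_factor p h k (x @ [y]) =
    hist_weight p h k x * (pmf (p (h \<circ>\<^sub>p x)) y - pmf (p x) y)"
  using assms by (simp add: lace_factor_def hist_weight_append nth_append)

section \<open>Forgetting the history\<close>

locale finite_range_walk =
  fixes p :: "'d::finite kernel" and L :: real
  assumes invariant: "translation_invariant p"
    and range: "finite_range p L"
begin

lemma pmf_long_step: "h \<noteq> [] \<Longrightarrow> norm (rvec (y - last h)) > L \<Longrightarrow> pmf (p h) y = 0"
  using range by (auto simp: finite_range_def)

lemma sum_pmf_steps:
  assumes "h \<noteq> []"
  shows "(\<Sum>v\<in>steps L. pmf (p h) (last h + v)) = 1"
proof -
  have "(\<Sum>v\<in>steps L. pmf (p h) (last h + v)) = (\<Sum>y\<in>(+) (last h) ` steps L. pmf (p h) y)"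
    by (simp add: sum.reindex)
  also have "\<dots> = 1"
  proof (rule sum_pmf_eq_1)
    show "set_pmf (p h) \<subseteq> (+) (last h) ` steps L"
    proof
      fix y assume "y \<in> set_pmf (p h)"
      then have "y - last h \<in> steps L"
        using pmf_long_step[OF assms, of y] by (force simp: steps_def set_pmf_iff)
      then show "y \<in> (+) (last h) ` steps L" by (rule image_eqI[rotated]) simp
    qed
  qed (simp add: finite_steps)
  finally show ?thesis .
qed

text \<open>The expected position \<open>n\<close> steps after the history \<open>h\<close>. Conditioning on the first step gives
  the recursion, and finite range makes it a finite sum, so that no integrals occur.\<close>

primrec mean_pos :: "nat \<Rightarrow> 'd path \<Rightarrow> real ^ 'd" where
  "mean_pos 0 h = rvec (last h)"
| "mean_pos (Suc n) h =
     (\<Sum>v\<in>steps L. pmf (p h) (last h + v) *\<^sub>R mean_pos n (h @ [last h + v]))"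

lemma mean_pos_translate:
  "h \<noteq> [] \<Longrightarrow> mean_pos n (map (\<lambda>x. x + u) h) = mean_pos n h + rvec u"
proof (induction n arbitrary: h)
  case 0
  then show ?case by (simp add: last_map rvec_add)
next
  case (Suc n)
  let ?t = "map (\<lambda>x. x + u)"
  have "mean_pos (Suc n) (?t h) =
      (\<Sum>v\<in>steps L. pmf (p h) (last h + v) *\<^sub>R (mean_pos n (h @ [last h + v]) + rvec u))"
    unfolding mean_pos.simps
  proof (rule sum.cong[OF refl])
    fix v :: "'d site"
    have l: "last (?t h) + v = (last h + v) + u" using Suc.prems by (simp add: last_map)
    have "mean_pos n (?t h @ [last (?t h) + v]) = mean_pos n (?t (h @ [last h + v]))"
      by (simp add: l)
    then show "pmf (p (?t h)) (last (?t h) + v) *\<^sub>R mean_pos n (?t h @ [last (?t h) + v]) =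
      pmf (p h) (last h + v) *\<^sub>R (mean_pos n (h @ [last h + v]) + rvec u)"
      using invariant Suc.prems unfolding l
      by (simp add: Suc.IH translation_invariant_def del: map_append)
  qed
  also have "\<dots> = mean_pos (Suc n) h + (\<Sum>v\<in>steps L. pmf (p h) (last h + v)) *\<^sub>R rvec u"
    by (simp add: scaleR_add_right sum.distrib scaleR_left.sum)
  finally show ?case by (simp add: sum_pmf_steps Suc.prems)
qed

lemma mean_pos_singleton: "mean_pos n [x] = rvec x + mean_pos n [0]"
  using mean_pos_translate[of "[0]" n x] by simp

text \<open>Markov property for histories. With \<open>n = 0\<close> and \<open>h = [0]\<close> it identifies \<open>mean_pos k [0]\<close> with
  the expectation of \<open>\<omega>\<^sub>k\<close>.\<close>

lemma sum_hist_weight_mean_pos: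
  assumes "h \<noteq> []"
  shows "(\<Sum>x\<in>bounded_paths L (last h) k. hist_weight p h k x *\<^sub>R mean_pos n (h \<circ>\<^sub>p x))
    = mean_pos (n + k) h"
proof (induction k arbitrary: n)
  case 0
  then show ?case by (simp add: hist_weight_0 path_concat_last_eq)
next
  case (Suc k)
  have "(\<Sum>x\<in>bounded_paths L (last h) (Suc k).
      hist_weight p h (Suc k) x *\<^sub>R mean_pos n (h \<circ>\<^sub>p x)) =
    (\<Sum>x\<in>bounded_paths L (last h) k. hist_weight p h k x *\<^sub>R mean_pos (Suc n) (h \<circ>\<^sub>p x))"
    unfolding sum_bounded_paths_Suc
  proof (rule sum.cong[OF refl])
    fix x assume x: "x \<in> bounded_paths L (last h) k"
    note b = bounded_paths_props[OF x]
    show "(\<Sum>v\<in>steps L. hist_weight p h (Suc k) (x @ [last x + v]) *\<^sub>R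
        mean_pos n (h \<circ>\<^sub>p (x @ [last x + v])))
      = hist_weight p h k x *\<^sub>R mean_pos (Suc n) (h \<circ>\<^sub>p x)"
      by (simp add: hist_weight_Suc b path_concat_append last_path_concat scaleR_sum_right)
  qed
  also have "\<dots> = mean_pos (Suc n + k) h" by (rule Suc.IH)
  finally show ?case by simp
qed

lemma sum_hist_weight:
  assumes "h \<noteq> []"
  shows "(\<Sum>x\<in>bounded_paths L (last h) k. hist_weight p h k x) = 1"
proof (induction k)
  case 0
  then show ?case by (simp add: hist_weight_0)
next
  case (Suc k)
  have "(\<Sum>x\<in>bounded_paths L (last h) (Suc k). hist_weight p h (Suc k) x) =
    (\<Sum>x\<in>bounded_paths L (last h) k. hist_weight p h k x)"
    unfolding sum_bounded_paths_Suc
  proof (rule sum.cong[OF refl])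
    fix x assume x: "x \<in> bounded_paths L (last h) k"
    note b = bounded_paths_props[OF x]
    show "(\<Sum>v\<in>steps L. hist_weight p h (Suc k) (x @ [last x + v])) = hist_weight p h k x"
      using sum_pmf_steps[of "h \<circ>\<^sub>p x"]
      by (simp add: hist_weight_Suc b last_path_concat path_concat_nonempty assms
          flip: sum_distrib_left)
  qed
  with Suc show ?case by simp
qed

text \<open>Telescoping over the moment at which the history is forgotten. The intermediate quantity \<open>D k\<close>
  below lets the walk make \<open>k\<close> steps with memory of \<open>h\<close> and then compares remembering with
  forgetting for the other \<open>c - k\<close> steps. One more step splits the comparison into a change of the
  transition probability, which is \<open>\<Delta>\<close>, and a comparison after that step, which is \<open>D (k + 1)\<close>.\<close>

lemma mean_pos_forget_history:
  assumes "h \<noteq> []"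
  shows "mean_pos c h - mean_pos c [last h] =
    (\<Sum>k<c. \<Sum>x\<in>bounded_paths L (last h) (Suc k). lace_factor p h k x *\<^sub>R mean_pos (c - Suc k) x)"
proof -
  define D where "D k = (\<Sum>x\<in>bounded_paths L (last h) k.
      hist_weight p h k x *\<^sub>R (mean_pos (c - k) (h \<circ>\<^sub>p x) - mean_pos (c - k) x))" for k
  have step: "D k = (\<Sum>x\<in>bounded_paths L (last h) (Suc k).
      lace_factor p h k x *\<^sub>R mean_pos (c - Suc k) x) + D (Suc k)" if "k < c" for k
    unfolding D_def sum_bounded_paths_Suc sum.distrib[symmetric]
  proof (rule sum.cong[OF refl])
    fix x assume x: "x \<in> bounded_paths L (last h) k"
    note b = bounded_paths_props[OF x]
    have c: "c - k = Suc (c - Suc k)" using that by simp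
    show "hist_weight p h k x *\<^sub>R (mean_pos (c - k) (h \<circ>\<^sub>p x) - mean_pos (c - k) x) =
      (\<Sum>v\<in>steps L. lace_factor p h k (x @ [last x + v]) *\<^sub>R
          mean_pos (c - Suc k) (x @ [last x + v]) +
        hist_weight p h (Suc k) (x @ [last x + v]) *\<^sub>R
          (mean_pos (c - Suc k) (h \<circ>\<^sub>p (x @ [last x + v])) -
           mean_pos (c - Suc k) (x @ [last x + v])))"
      unfolding c mean_pos.simps
      by (simp add: lace_factor_append hist_weight_Suc b path_concat_append last_path_concat
          scaleR_sum_right algebra_simps flip: sum_subtractf)
  qed
  have "D 0 = (\<Sum>k<n. \<Sum>x\<in>bounded_paths L (last h) (Suc k).
      lace_factor p h k x *\<^sub>R mean_pos (c - Suc k) x) + D n" if "n \<le> c" for n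
    using that
  proof (induction n)
    case (Suc n)
    then show ?case using step[of n] by (simp add: add.assoc)
  qed simp
  from this[of c] have "D 0 = (\<Sum>k<c. \<Sum>x\<in>bounded_paths L (last h) (Suc k).
      lace_factor p h k x *\<^sub>R mean_pos (c - Suc k) x) + D c" by simp
  moreover have "D 0 = mean_pos c h - mean_pos c [last h]"
    by (simp add: D_def hist_weight_0 path_concat_last_eq)
  moreover have "D c = 0"
    unfolding D_def by (rule sum.neutral) (auto simp: last_path_concat bounded_paths_props)
  ultimately show ?thesis by simp
qed

lemma sum_lace_factor:
  assumes "h \<noteq> []"
  shows "(\<Sum>x\<in>bounded_paths L (last h) (Suc k). lace_factor p h k x) = 0"
  unfolding sum_bounded_paths_Suc
proof (rule sum.neutral, safe)
  fix x assume x: "x \<in> bounded_paths L (last h) k"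
  note b = bounded_paths_props[OF x]
  show "(\<Sum>v\<in>steps L. lace_factor p h k (x @ [last x + v])) = 0"
    using sum_pmf_steps[of "h \<circ>\<^sub>p x"] sum_pmf_steps[of x]
    by (simp add: lace_factor_append b last_path_concat path_concat_nonempty assms
        sum_subtractf flip: sum_distrib_left)
qed

text \<open>The influence on the mean position of everything in the history before the present site.\<close>

definition memory :: "nat \<Rightarrow> 'd path \<Rightarrow> real ^ 'd" where
  "memory n h = mean_pos n h - mean_pos n [last h]"

text \<open>The remaining walk after the factor \<open>\<Delta>\<close> is split into memory term, present position and the mean
  displacement of a walk without history. The last one does not depend on the path, so it is
  cancelled by \<open>sum_lace_factor\<close>.\<close>

lemma memory_expand:
  assumes "h \<noteq> []"
  shows "memory c h = (\<Sum>k<c. \<Sum>x\<in>bounded_paths L (last h) (Suc k).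
    lace_factor p h k x *\<^sub>R (memory (c - Suc k) x + rvec (last x)))"
  unfolding memory_def mean_pos_forget_history[OF assms]
proof (rule sum.cong[OF refl])
  fix k
  have "(\<Sum>x\<in>bounded_paths L (last h) (Suc k). lace_factor p h k x *\<^sub>R mean_pos (c - Suc k) x)
    = (\<Sum>x\<in>bounded_paths L (last h) (Suc k). lace_factor p h k x *\<^sub>R
        (mean_pos (c - Suc k) x - mean_pos (c - Suc k) [last x] + rvec (last x)))
      + (\<Sum>x\<in>bounded_paths L (last h) (Suc k). lace_factor p h k x) *\<^sub>R mean_pos (c - Suc k) [0]"
    unfolding scaleR_left.sum sum.distrib[symmetric]
    by (rule sum.cong[OF refl]) (subst mean_pos_singleton, simp add: algebra_simps)
  then show "(\<Sum>x\<in>bounded_paths L (last h) (Suc k). lace_factor p h k x *\<^sub>R mean_pos (c - Suc k) x)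
    = (\<Sum>x\<in>bounded_paths L (last h) (Suc k). lace_factor p h k x *\<^sub>R
        (mean_pos (c - Suc k) x - mean_pos (c - Suc k) [last x] + rvec (last x)))"
    by (simp only: sum_lace_factor[OF assms] scaleR_zero_left add_0_right)
qed

end

section \<open>The index sets of the lace expansion\<close>

text \<open>The families of paths that can have nonzero lace weight.\<close>

definition bounded_lace_paths ::
    "real \<Rightarrow> (nat \<Rightarrow> nat) \<Rightarrow> nat \<Rightarrow> (nat \<Rightarrow> 'd::finite path) set" where
  "bounded_lace_paths L j N =
     {W \<in> lace_paths j N. \<forall>n\<le>N. W n \<in> bounded_paths L (hd (W n)) (Suc (j n))}"

lemma bounded_lace_paths_cong:
  assumes "\<And>n. n \<le> N \<Longrightarrow> j n = j' n"
  shows "bounded_lace_paths L j N = bounded_lace_paths L j' N"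
  using assms by (auto simp: bounded_lace_paths_def lace_paths_def)

lemma bounded_lace_paths_0:
  assumes "j 0 = 0"
  shows "bounded_lace_paths L j 0 = (\<lambda>v. (\<lambda>_. [])(0 := [0, v])) ` steps L"
proof (intro set_eqI iffI)
  fix W :: "nat \<Rightarrow> 'a path"
  assume "W \<in> bounded_lace_paths L j 0"
  then have W: "W 0 \<in> bounded_paths L 0 (Suc 0)" "\<And>n. n > 0 \<Longrightarrow> W n = []"
    using assms by (auto simp: bounded_lace_paths_def lace_paths_def)
  then obtain v where "v \<in> steps L" "W 0 = [0, v]"
    by (auto simp: bounded_paths_1)
  with W(2) show "W \<in> (\<lambda>v. (\<lambda>_. [])(0 := [0, v])) ` steps L"
    by (intro image_eqI[where x = v]) (auto simp: fun_eq_iff)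
next
  fix W :: "nat \<Rightarrow> 'a path"
  assume "W \<in> (\<lambda>v. (\<lambda>_. [])(0 := [0, v])) ` steps L"
  then obtain v where v: "v \<in> steps L" "W = (\<lambda>_. [])(0 := [0, v])" by auto
  have "[0, v] \<in> bounded_paths L 0 (Suc 0)"
    using v(1) by (simp add: bounded_paths_1)
  with v(2) assms show "W \<in> bounded_lace_paths L j 0"
    by (auto simp: bounded_lace_paths_def lace_paths_def)
qed

text \<open>Families are extended by a new last path, which only has to start where the previous one ends.
  This peeling from the end leaves the positions of the other paths unchanged.\<close>

lemma bounded_lace_paths_Suc:
  "bounded_lace_paths L j (Suc N) = (\<lambda>(W, x). W(Suc N := x)) `
     (SIGMA W:bounded_lace_paths L j N. bounded_paths L (last (W N)) (Suc (j (Suc N))))"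
  (is "?A = ?f ` ?S")
proof (intro set_eqI iffI)
  fix W
  assume W: "W \<in> ?A"
  then have "W(Suc N := []) \<in> bounded_lace_paths L j N"
    by (auto simp: bounded_lace_paths_def lace_paths_def)
  moreover have "W (Suc N) \<in> bounded_paths L (last (W N)) (Suc (j (Suc N)))"
    using W by (auto simp: bounded_lace_paths_def lace_paths_def)
  ultimately show "W \<in> ?f ` ?S"
    by (intro image_eqI[where x = "(W(Suc N := []), W (Suc N))"])
      auto
next
  fix W
  assume "W \<in> ?f ` ?S"
  then obtain z where z: "z \<in> ?S" "W = ?f z" by (rule imageE)
  obtain V x where Vx: "z = (V, x)" by (cases z)
  then have W: "W = V(Suc N := x)" using z(2) by simp
  from z Vx have V: "V \<in> bounded_lace_paths L j N"
    and x: "x \<in> bounded_paths L (last (V N)) (Suc (j (Suc N)))" by blast+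
  show "W \<in> ?A"
    using V x bounded_paths_props[OF x] unfolding W
    by (auto simp: bounded_lace_paths_def lace_paths_def le_Suc_eq)
qed

lemma bounded_lace_pathsD:
  assumes "W \<in> bounded_lace_paths L j N"
  shows "W N \<noteq> []" "n > N \<Longrightarrow> W n = []"
  using assms by (auto simp: bounded_lace_paths_def lace_paths_def)

lemma finite_bounded_lace_paths:
  assumes "j 0 = 0"
  shows "finite (bounded_lace_paths L j N)"
  by (induction N)
    (auto simp: bounded_lace_paths_0 assms finite_steps bounded_lace_paths_Suc
      finite_bounded_paths)

lemma sum_bounded_lace_paths_Suc:
  fixes f :: "(nat \<Rightarrow> 'd::finite path) \<Rightarrow> 'b::comm_monoid_add"
  assumes "j 0 = 0"
  shows "(\<Sum>W\<in>bounded_lace_paths L j (Suc N). f W) =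
    (\<Sum>W\<in>bounded_lace_paths L j N.
      \<Sum>x\<in>bounded_paths L (last (W N)) (Suc (j (Suc N))). f (W(Suc N := x)))"
proof -
  have "inj_on (\<lambda>(W, x). W(Suc N := x)) (SIGMA W:bounded_lace_paths L j N.
      bounded_paths L (last (W N)) (Suc (j (Suc N))))"
  proof (rule inj_onI)
    fix a b
    assume a: "a \<in> (SIGMA W:bounded_lace_paths L j N.
          bounded_paths L (last (W N)) (Suc (j (Suc N))))"
      and b: "b \<in> (SIGMA W:bounded_lace_paths L j N.
          bounded_paths L (last (W N)) (Suc (j (Suc N))))"
      and ab: "(\<lambda>(W, x). W(Suc N := x)) a = (\<lambda>(W, x). W(Suc N := x)) b"
    obtain V x W y where xy: "a = (V, x)" "b = (W, y)" by (cases a, cases b)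
    from ab have eq: "V(Suc N := x) = W(Suc N := y)" by (simp add: xy)
    from a b have "V \<in> bounded_lace_paths L j N" "W \<in> bounded_lace_paths L j N"
      by (simp_all add: xy)
    then have "V (Suc N) = W (Suc N)" by (simp add: bounded_lace_pathsD)
    with eq have "V = W" by (metis fun_upd_triv fun_upd_upd)
    moreover from eq have "x = y" by (metis fun_upd_same)
    ultimately show "a = b" by (simp add: xy)
  qed
  from sum.reindex[OF this, of f] show ?thesis unfolding bounded_lace_paths_Suc
    by (simp add: case_prod_unfold sum.Sigma finite_bounded_lace_paths assms
        finite_bounded_paths)
qed

lemma lace_indices_empty: "m \<le> N \<Longrightarrow> lace_indices m N = {}"
  by (auto simp: lace_indices_def)

lemma lace_indices_0: "lace_indices m 0 = (if m = 1 then {\<lambda>_. 0} else {})"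
  by (auto simp: lace_indices_def)

lemma lace_indicesD: "j \<in> lace_indices m N \<Longrightarrow> n \<notin> {1..N} \<Longrightarrow> j n = 0"
  by (simp add: lace_indices_def)

text \<open>A new entry \<open>k\<close> accounts for a path of \<open>k + 1\<close> steps, so the total number of steps \<open>m\<close> grows by
  \<open>k + 1\<close>.\<close>

lemma lace_indices_Suc:
  "lace_indices m (Suc N) = (\<lambda>(k, j). j(Suc N := k)) ` (SIGMA k:{..<m}. lace_indices (m - Suc k) N)"
proof (intro set_eqI iffI)
  fix j
  assume j: "j \<in> lace_indices m (Suc N)"
  have "(\<Sum>n=1..N. (j(Suc N := 0)) n) = (\<Sum>n=1..N. j n)" by (rule sum.cong) auto
  with j have "j(Suc N := 0) \<in> lace_indices (m - Suc (j (Suc N))) N" "j (Suc N) < m"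
    by (auto simp: lace_indices_def)
  then show "j \<in> (\<lambda>(k, j). j(Suc N := k)) ` (SIGMA k:{..<m}. lace_indices (m - Suc k) N)"
    by (intro image_eqI[where x = "(j (Suc N), j(Suc N := 0))"]) auto
next
  fix j
  assume "j \<in> (\<lambda>(k, j). j(Suc N := k)) ` (SIGMA k:{..<m}. lace_indices (m - Suc k) N)"
  then obtain k i where i: "i \<in> lace_indices (m - Suc k) N" "k < m" and j: "j = i(Suc N := k)"
    by auto
  have "(\<Sum>n=1..N. (i(Suc N := k)) n) = (\<Sum>n=1..N. i n)" by (rule sum.cong) auto
  with i show "j \<in> lace_indices m (Suc N)" unfolding j by (auto simp: lace_indices_def)
qed

lemma finite_lace_indices: "finite (lace_indices m N)"
  by (induction N arbitrary: m) (auto simp: lace_indices_0 lace_indices_Suc)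

lemma sum_lace_indices_Suc:
  fixes f :: "(nat \<Rightarrow> nat) \<Rightarrow> 'b::comm_monoid_add"
  shows "(\<Sum>j\<in>lace_indices m (Suc N). f j) =
    (\<Sum>k<m. \<Sum>j\<in>lace_indices (m - Suc k) N. f (j(Suc N := k)))"
proof -
  have "inj_on (\<lambda>(k, j). j(Suc N := k)) (SIGMA k:{..<m}. lace_indices (m - Suc k) N)"
  proof (rule inj_onI)
    fix a b
    assume a: "a \<in> (SIGMA k:{..<m}. lace_indices (m - Suc k) N)"
      and b: "b \<in> (SIGMA k:{..<m}. lace_indices (m - Suc k) N)"
      and ab: "(\<lambda>(k, j). j(Suc N := k)) a = (\<lambda>(k, j). j(Suc N := k)) b"
    obtain k i l j where ij: "a = (k, i)" "b = (l, j)" by (cases a, cases b)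
    from ab have eq: "i(Suc N := k) = j(Suc N := l)" by (simp add: ij)
    from a b have "i \<in> lace_indices (m - Suc k) N" "j \<in> lace_indices (m - Suc l) N"
      by (simp_all add: ij)
    then have "i (Suc N) = j (Suc N)" by (simp add: lace_indicesD)
    with eq have "i = j" by (metis fun_upd_triv fun_upd_upd)
    moreover from eq have "k = l" by (metis fun_upd_same)
    ultimately show "a = b" by (simp add: ij)
  qed
  then show ?thesis unfolding lace_indices_Suc
    by (simp add: sum.reindex case_prod_unfold sum.Sigma finite_lace_indices)
qed

lemma lace_weight_eq_prod_lace_factor:
  "lace_weight p j N W =
     step_prob p (W 0 ! 1) * (\<Prod>n=1..N. lace_factor p (W (n - 1)) (j n) (W n))"
  by (simp add: lace_weight_def lace_\<Delta>_def lace_factor_def hist_weight_def)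

lemma lace_weight_Suc:
  "lace_weight p (j(Suc N := k)) (Suc N) (W(Suc N := x)) =
     lace_weight p j N W * lace_factor p (W N) k x"
proof -
  have "(\<Prod>n=1..N. lace_factor p ((W(Suc N := x)) (n - 1)) ((j(Suc N := k)) n) ((W(Suc N := x)) n))
    = (\<Prod>n=1..N. lace_factor p (W (n - 1)) (j n) (W n))"
    by (rule prod.cong) auto
  then show ?thesis by (simp add: lace_weight_eq_prod_lace_factor)
qed

lemma first_moment_point_masses:
  assumes "finite I"
  shows "first_moment (\<lambda>y. \<Sum>i\<in>I. of_bool (e i = y) * w i) = (\<Sum>i\<in>I. w i *\<^sub>R rvec (e i))"
proof -
  let ?f = "\<lambda>y. (\<Sum>i\<in>I. of_bool (e i = y) * w i) *\<^sub>R rvec y"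
  have "infsum ?f UNIV = infsum ?f (e ` I)"
    by (rule infsum_cong_neutral) (auto intro!: sum.neutral)
  also have "\<dots> = (\<Sum>y\<in>e ` I. \<Sum>i\<in>I. (of_bool (e i = y) * w i) *\<^sub>R rvec y)"
    using assms by (simp only: infsum_finite finite_imageI scaleR_left.sum)
  also have "\<dots> = (\<Sum>i\<in>I. \<Sum>y\<in>e ` I. (of_bool (e i = y) * w i) *\<^sub>R rvec y)"
    by (rule sum.swap)
  also have "\<dots> = (\<Sum>i\<in>I. w i *\<^sub>R rvec (e i))"
  proof (rule sum.cong[OF refl])
    fix i assume i: "i \<in> I"
    have "(\<Sum>y\<in>e ` I. (of_bool (e i = y) * w i) *\<^sub>R rvec y)
      = (\<Sum>y\<in>e ` I. if e i = y then w i *\<^sub>R rvec y else 0)"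
      by (rule sum.cong) auto
    then show "(\<Sum>y\<in>e ` I. (of_bool (e i = y) * w i) *\<^sub>R rvec y) = w i *\<^sub>R rvec (e i)"
      using assms i by (simp add: sum.delta)
  qed
  finally show ?thesis by (simp add: first_moment_def)
qed

context finite_range_walk
begin

lemma lace_factor_eq_0:
  assumes h: "h \<noteq> []" "last h = hd x" and len: "length x = k + 2"
    and nb: "x \<notin> bounded_paths L (hd x) (Suc k)"
  shows "lace_factor p h k x = 0"
proof -
  have "length x = Suc (Suc k)" using len by simp
  from long_step_if_not_bounded_path[OF this nb] obtain i where
    i: "i < Suc k" "norm (rvec (x ! Suc i - x ! i)) > L" by auto
  have ne: "take (i + 1) x \<noteq> []" "hd (take (i + 1) x) = hd x" using len by auto
  have "last (take (i + 1) x) = x ! i" using i len ne(1) by (auto simp: last_conv_nth min_def)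
  then have z: "pmf (p (h \<circ>\<^sub>p take (i + 1) x)) (x ! (i + 1)) = 0"
    "pmf (p (take (i + 1) x)) (x ! (i + 1)) = 0"
    using pmf_long_step[of "h \<circ>\<^sub>p take (i + 1) x"] pmf_long_step[of "take (i + 1) x"] h ne i(2)
    by (simp_all add: last_path_concat path_concat_nonempty)
  show ?thesis
  proof (cases "i = k")
    case True
    then show ?thesis using z by (simp add: lace_factor_def)
  next
    case False
    with i have "i < k" by simp
    then have "hist_weight p h k x = 0" unfolding hist_weight_def using z(1)
      by (intro prod_zero) auto
    then show ?thesis by (simp add: lace_factor_def)
  qed
qed

text \<open>Consecutive paths fit together, so the last site of each history is the site from which the
  next step is made; a long step therefore kills the factor in which it occurs.\<close>

lemma lace_weight_eq_0:
  assumes W: "W \<in> lace_paths j N" "W \<notin> bounded_lace_paths L j N" and j: "j 0 = 0"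
  shows "lace_weight p j N W = 0"
proof -
  from W obtain n where n: "n \<le> N" "W n \<notin> bounded_paths L (hd (W n)) (Suc (j n))"
    by (auto simp: bounded_lace_paths_def)
  have len: "length (W k) = j k + 2" if "k \<le> N" for k using W that by (simp add: lace_paths_def)
  show ?thesis
  proof (cases n)
    case 0
    have "length (W 0) = Suc (Suc 0)" using len[of 0] j by simp
    moreover have "W 0 \<notin> bounded_paths L (hd (W 0)) (Suc 0)"
      using n j unfolding 0 by simp
    ultimately have "\<exists>i<Suc 0. norm (rvec (W 0 ! Suc i - W 0 ! i)) > L"
      by (rule long_step_if_not_bounded_path)
    then have "norm (rvec (W 0 ! 1 - W 0 ! 0)) > L" by auto
    moreover have "W 0 ! 0 = 0"
      using W(1) \<open>length (W 0) = Suc (Suc 0)\<close> by (cases "W 0") (auto simp: lace_paths_def)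
    ultimately have "step_prob p (W 0 ! 1) = 0"
      using pmf_long_step[of "[0]"] by (simp add: step_prob_def)
    then show ?thesis by (simp add: lace_weight_def)
  next
    case (Suc l)
    have "lace_factor p (W l) (j n) (W n) = 0"
    proof (rule lace_factor_eq_0)
      show "W l \<noteq> []" using len[of l] n Suc by auto
      show "last (W l) = hd (W n)" using W(1) n(1) Suc by (auto simp: lace_paths_def)
    qed (use len n in auto)
    then have "(\<Prod>n=1..N. lace_factor p (W (n - 1)) (j n) (W n)) = 0"
      using n Suc by (intro prod_zero) (auto intro!: bexI[of _ n])
    then show ?thesis by (simp add: lace_weight_eq_prod_lace_factor)
  qed
qed

section \<open>Iterating the expansion\<close>

text \<open>The lace weights integrate a function of the last path, rather than of its endpoint, because
  the expansion continues with that path as history.\<close>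

definition lace_sum :: "nat \<Rightarrow> nat \<Rightarrow> ('d path \<Rightarrow> real ^ 'd) \<Rightarrow> real ^ 'd" where
  "lace_sum m N F =
     (\<Sum>j\<in>lace_indices m N. \<Sum>W\<in>bounded_lace_paths L j N. lace_weight p j N W *\<^sub>R F (W N))"

lemma lace_sum_cong:
  assumes "\<And>h. h \<noteq> [] \<Longrightarrow> F h = G h"
  shows "lace_sum m N F = lace_sum m N G"
  unfolding lace_sum_def by (intro sum.cong) (auto simp: assms bounded_lace_pathsD)

lemma lace_sum_add: "lace_sum m N (\<lambda>h. F h + G h) = lace_sum m N F + lace_sum m N G"
  by (simp add: lace_sum_def scaleR_add_right sum.distrib)

lemma lace_sum_sum: "lace_sum m N (\<lambda>h. \<Sum>k\<in>K. F k h) = (\<Sum>k\<in>K. lace_sum m N (F k))"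
  unfolding lace_sum_def scaleR_sum_right
  by (simp only: sum.swap[where B = K])

lemma lace_sum_0:
  "lace_sum m 0 F = (if m = 1 then \<Sum>v\<in>steps L. step_prob p v *\<^sub>R F [0, v] else 0)"
proof -
  have inj: "inj_on (\<lambda>v. (\<lambda>_. [])(0 := [0, v])) (steps L :: 'd site set)"
    by (rule inj_onI) (metis fun_upd_same list.inject)
  have "(\<Sum>W\<in>bounded_lace_paths L (\<lambda>_. 0) 0. lace_weight p (\<lambda>_. 0) 0 W *\<^sub>R F (W 0)) =
      (\<Sum>v\<in>steps L. step_prob p v *\<^sub>R F [0, v])"
    by (subst bounded_lace_paths_0, simp, subst sum.reindex[OF inj], simp add: lace_weight_def)
  then show ?thesis by (simp add: lace_sum_def lace_indices_0)
qed

lemma lace_sum_empty: "m \<le> N \<Longrightarrow> lace_sum m N F = 0"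
  by (simp add: lace_sum_def lace_indices_empty)

lemma lace_sum_Suc:
  "lace_sum m (Suc N) F = (\<Sum>k<m. lace_sum (m - Suc k) N
     (\<lambda>h. \<Sum>x\<in>bounded_paths L (last h) (Suc k). lace_factor p h k x *\<^sub>R F x))"
  unfolding lace_sum_def sum_lace_indices_Suc
proof (rule sum.cong[OF refl], rule sum.cong[OF refl])
  fix k j
  assume j: "j \<in> lace_indices (m - Suc k) N"
  then have j0: "(j(Suc N := k)) 0 = 0" by (simp add: lace_indicesD)
  have c: "bounded_lace_paths L (j(Suc N := k)) N = bounded_lace_paths L j N"
    by (rule bounded_lace_paths_cong) simp
  show "(\<Sum>W\<in>bounded_lace_paths L (j(Suc N := k)) (Suc N).
        lace_weight p (j(Suc N := k)) (Suc N) W *\<^sub>R F (W (Suc N))) =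
    (\<Sum>W\<in>bounded_lace_paths L j N. lace_weight p j N W *\<^sub>R
      (\<Sum>x\<in>bounded_paths L (last (W N)) (Suc k). lace_factor p (W N) k x *\<^sub>R F x))"
    unfolding sum_bounded_lace_paths_Suc[where j = "j(Suc N := k)", OF j0] c
    by (simp add: lace_weight_Suc scaleR_sum_right)
qed

text \<open>One round of the expansion inside the lace sums. The index \<open>m\<close> counts the steps used so far out of
  a total of \<open>M\<close>; applying \<open>memory_expand\<close> to the remaining \<open>M - m\<close> steps adds one path of
  \<open>k + 1\<close> steps, and resummation over the new total \<open>m + k + 1\<close> gives lace sums with \<open>N + 1\<close>
  paths.\<close>

lemma memory_lace_step:
  "(\<Sum>m\<le>M. lace_sum m N (memory (M - m))) =
   (\<Sum>m\<le>M. lace_sum m (Suc N) (memory (M - m)))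
   + (\<Sum>m\<le>M. lace_sum m (Suc N) (\<lambda>x. rvec (last x)))"
proof -
  define G where "G m k h = (\<Sum>x\<in>bounded_paths L (last h) (Suc k).
      lace_factor p h k x *\<^sub>R (memory (M - m) x + rvec (last x)))" for m k h
  have "(\<Sum>m\<le>M. lace_sum m N (memory (M - m))) =
      (\<Sum>m\<le>M. \<Sum>k<M - m. lace_sum m N (G (m + Suc k) k))"
  proof (rule sum.cong[OF refl])
    fix m
    have "lace_sum m N (memory (M - m)) = lace_sum m N (\<lambda>h. \<Sum>k<M - m. G (m + Suc k) k h)"
      by (rule lace_sum_cong) (simp add: memory_expand G_def)
    then show "lace_sum m N (memory (M - m)) = (\<Sum>k<M - m. lace_sum m N (G (m + Suc k) k))"
      by (simp add: lace_sum_sum)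
  qed
  also have "\<dots> = (\<Sum>(m, k)\<in>(SIGMA m:{..M}. {..<M - m}). lace_sum m N (G (m + Suc k) k))"
    by (rule sum.Sigma) auto
  also have "\<dots> = (\<Sum>(m, k)\<in>(SIGMA m:{..M}. {..<m}). lace_sum (m - Suc k) N (G m k))"
    \<comment> \<open>The new \<open>m\<close> is the number of steps used including the path just added.\<close>
    by (rule sum.reindex_bij_witness[where
          i = "\<lambda>(m, k). (m - Suc k, k)" and j = "\<lambda>(m, k). (m + Suc k, k)"]) auto
  also have "\<dots> = (\<Sum>m\<le>M. \<Sum>k<m. lace_sum (m - Suc k) N (G m k))"
    by (rule sum.Sigma[symmetric]) auto
  also have "\<dots> = (\<Sum>m\<le>M. lace_sum m (Suc N) (\<lambda>x. memory (M - m) x + rvec (last x)))"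
    unfolding lace_sum_Suc G_def ..
  finally show ?thesis by (simp add: lace_sum_add sum.distrib)
qed

lemma lace_piN_eq:
  "lace_piN p m N y = (\<Sum>j\<in>lace_indices m N. \<Sum>W\<in>bounded_lace_paths L j N.
     of_bool (last (W N) = y) * lace_weight p j N W)"
  unfolding lace_piN_def
proof (rule sum.cong[OF refl])
  fix j assume "j \<in> lace_indices m N"
  then have j: "j 0 = 0" by (simp add: lace_indicesD)
  have "(\<Sum>\<^sub>\<infinity>W\<in>lace_paths j N. of_bool (last (W N) = y) * lace_weight p j N W) =
    (\<Sum>\<^sub>\<infinity>W\<in>bounded_lace_paths L j N. of_bool (last (W N) = y) * lace_weight p j N W)"
    by (rule infsum_cong_neutral) (auto simp: lace_weight_eq_0 j bounded_lace_paths_def)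
  then show "(\<Sum>\<^sub>\<infinity>W\<in>lace_paths j N. of_bool (last (W N) = y) * lace_weight p j N W) =
    (\<Sum>W\<in>bounded_lace_paths L j N. of_bool (last (W N) = y) * lace_weight p j N W)"
    by (simp add: finite_bounded_lace_paths j)
qed

text \<open>All the sums in \<open>lace_pi\<close> are combined into one finite sum of point masses, whose first moment
  is the sum of the weighted positions. Terms with \<open>N \<ge> m\<close> vanish because \<open>lace_indices m N\<close> is
  then empty.\<close>

lemma first_moment_lace_pi:
  assumes "m \<le> M"
  shows "first_moment (lace_pi p m) = (\<Sum>N=1..M. lace_sum m N (\<lambda>x. rvec (last x)))"
proof -
  define I :: "(nat \<times> (nat \<Rightarrow> nat) \<times> (nat \<Rightarrow> 'd path)) set"
    where "I = (SIGMA N:{1..M}. SIGMA j:lace_indices m N. bounded_lace_paths L j N)"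
  have fin: "finite (bounded_lace_paths L j N :: (nat \<Rightarrow> 'd path) set)" if "j \<in> lace_indices m N" for j N
    using that by (intro finite_bounded_lace_paths) (simp add: lace_indicesD)
  have finI: "finite I" unfolding I_def by (auto simp: finite_lace_indices fin)
  have nest: "(\<Sum>N=1..M. \<Sum>j\<in>lace_indices m N. \<Sum>W\<in>bounded_lace_paths L j N. f N j W) =
      (\<Sum>(N, j, W)\<in>I. f N j W)" for f :: "nat \<Rightarrow> (nat \<Rightarrow> nat) \<Rightarrow> (nat \<Rightarrow> 'd path) \<Rightarrow> 'b::comm_monoid_add"
    unfolding I_def by (simp add: sum.Sigma finite_lace_indices fin)
  have "lace_pi p m = (\<lambda>y. \<Sum>i\<in>I. of_bool ((case i of (N, j, W) \<Rightarrow> last (W N)) = y) *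
      (case i of (N, j, W) \<Rightarrow> lace_weight p j N W))"
  proof
    fix y
    have "lace_pi p m y = (\<Sum>\<^sub>\<infinity>N\<in>{1..M}. lace_piN p m N y)"
      unfolding lace_pi_def using assms
      by (intro infsum_cong_neutral) (auto simp: lace_piN_def lace_indices_empty)
    also have "\<dots> = (\<Sum>N=1..M. lace_piN p m N y)" by simp
    finally show "lace_pi p m y =
        (\<Sum>i\<in>I. of_bool ((case i of (N, j, W) \<Rightarrow> last (W N)) = y) *
          (case i of (N, j, W) \<Rightarrow> lace_weight p j N W))"
      unfolding lace_piN_eq nest case_prod_unfold .
  qed
  then have "first_moment (lace_pi p m) = (\<Sum>i\<in>I. (case i of (N, j, W) \<Rightarrow> lace_weight p j N W)
      *\<^sub>R rvec (case i of (N, j, W) \<Rightarrow> last (W N)))"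
    by (simp only: first_moment_point_masses[OF finI])
  then show ?thesis unfolding lace_sum_def nest case_prod_unfold .
qed

lemma first_moment_step_prob: "first_moment (step_prob p) = (\<Sum>v\<in>steps L. step_prob p v *\<^sub>R rvec v)"
proof -
  have "first_moment (step_prob p) = (\<Sum>\<^sub>\<infinity>v\<in>steps L. step_prob p v *\<^sub>R rvec v)"
    unfolding first_moment_def using pmf_long_step[of "[0]"]
    by (intro infsum_cong_neutral) (auto simp: steps_def step_prob_def)
  then show ?thesis by (simp add: finite_steps)
qed

text \<open>The first step is made without history and leaves a walk with history \<open>(0, \<omega>\<^sub>1)\<close>, whose mean
  position after \<open>n\<close> more steps is \<open>\<omega>\<^sub>1 + a\<^sub>n\<close> plus a memory term. The memory term is the lace sum
  with \<open>N = 0\<close>; unrolling it until no steps are left yields the expansion coefficients.\<close>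

lemma mean_pos_increment:
  "mean_pos (Suc n) [0] - mean_pos n [0] =
     first_moment (step_prob p) + (\<Sum>m=2..Suc n. first_moment (lace_pi p m))"
proof -
  define M where "M = Suc n"
  define B where "B N = (\<Sum>m\<le>M. lace_sum m N (memory (M - m)))" for N
  define C where "C N = (\<Sum>m\<le>M. lace_sum m N (\<lambda>x. rvec (last x)))" for N
  have "B 0 = (\<Sum>N=1..K. C N) + B K" for K
  proof (induction K)
    case (Suc K)
    have "B K = B (Suc K) + C (Suc K)" unfolding B_def C_def by (rule memory_lace_step)
    with Suc show ?case by simp
  qed simp
  \<comment> \<open>\<open>M + 1\<close> paths have at least \<open>M + 1\<close> steps in total, more than the \<open>M\<close> available.\<close>
  moreover have "B M = 0" by (simp add: B_def lace_sum_empty)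
  ultimately have "B 0 = (\<Sum>N=1..M. C N)" by (metis add.right_neutral)
  also have "\<dots> = (\<Sum>m\<le>M. \<Sum>N=1..M. lace_sum m N (\<lambda>x. rvec (last x)))"
    unfolding C_def by (rule sum.swap)
  \<comment> \<open>Two or more paths need at least two steps.\<close>
  also have "\<dots> = (\<Sum>m=2..M. \<Sum>N=1..M. lace_sum m N (\<lambda>x. rvec (last x)))"
    by (rule sum.mono_neutral_right) (auto intro!: sum.neutral lace_sum_empty)
  also have "\<dots> = (\<Sum>m=2..M. first_moment (lace_pi p m))"
    by (rule sum.cong) (simp_all add: first_moment_lace_pi[of _ M])
  finally have B0: "B 0 = (\<Sum>m=2..M. first_moment (lace_pi p m))" .
  have "B 0 = (\<Sum>v\<in>steps L. step_prob p v *\<^sub>R memory n [0, v])"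
    by (simp add: B_def lace_sum_0 M_def sum.delta if_distrib cong: if_cong)
  moreover have "mean_pos (Suc n) [0] =
      (\<Sum>v\<in>steps L. step_prob p v *\<^sub>R (rvec v + mean_pos n [0] + memory n [0, v]))"
  proof -
    have "rvec v + mean_pos n [0] + memory n [0, v] = mean_pos n [0, v]" for v
      unfolding memory_def by (subst (2) mean_pos_singleton) simp
    then show ?thesis by (simp add: step_prob_def)
  qed
  moreover have "\<dots> = first_moment (step_prob p)
      + (\<Sum>v\<in>steps L. step_prob p v) *\<^sub>R mean_pos n [0]
      + (\<Sum>v\<in>steps L. step_prob p v *\<^sub>R memory n [0, v])"
    by (simp add: first_moment_step_prob scaleR_add_right sum.distrib scaleR_left.sum)
  moreover have "(\<Sum>v\<in>steps L. step_prob p v) = 1"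
    using sum_pmf_steps[of "[0]"] by (simp add: step_prob_def)
  ultimately show ?thesis using B0 by (simp add: M_def)
qed

end

section \<open>The speed as the limit of mean positions\<close>

lemma cesaro_mean_tendsto:
  fixes f :: "nat \<Rightarrow> 'a::real_normed_vector"
  assumes "f \<longlonglongrightarrow> l"
  shows "(\<lambda>n. (1 / real n) *\<^sub>R (\<Sum>k<n. f k)) \<longlonglongrightarrow> l"
proof (rule LIMSEQ_I)
  fix e :: real
  assume e: "e > 0"
  then obtain K where K: "norm (f k - l) < e / 2" if "k \<ge> K" for k
    using LIMSEQ_D[OF assms, of "e / 2"] by auto
  define R where "R = (\<Sum>k<K. norm (f k - l))"
  \<comment> \<open>Beyond \<open>n0\<close>, the first \<open>K\<close> terms contribute less than \<open>e / 2\<close> to the mean.\<close>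
  obtain n0 :: nat where n0: "real n0 > 2 * R / e" using reals_Archimedean2 by blast
  have "norm ((1 / real n) *\<^sub>R (\<Sum>k<n. f k) - l) < e" if n: "n \<ge> Suc (max K n0)" for n
  proof -
    have npos: "real n > 0" and Kn: "K \<le> n" using n by auto
    have "(1 / real n) *\<^sub>R (\<Sum>k<n. f k) - l = (1 / real n) *\<^sub>R (\<Sum>k<n. f k - l)"
      using npos by (simp add: sum_subtractf scaleR_diff_right sum_constant_scaleR)
    then have "norm ((1 / real n) *\<^sub>R (\<Sum>k<n. f k) - l) = norm (\<Sum>k<n. f k - l) / real n"
      by simp
    also have "norm (\<Sum>k<n. f k - l) \<le> (\<Sum>k<n. norm (f k - l))" by (rule norm_sum)
    also have "(\<Sum>k<n. norm (f k - l)) = R + (\<Sum>k=K..<n. norm (f k - l))"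
      unfolding R_def lessThan_atLeast0 using Kn by (simp add: sum.atLeastLessThan_concat)
    also have "(\<Sum>k=K..<n. norm (f k - l)) \<le> (\<Sum>k=K..<n. e / 2)"
      using K by (intro sum_mono) (auto intro: less_imp_le)
    also have "\<dots> \<le> real n * (e / 2)" using e by (simp add: mult_right_mono)
    also have "R < real n * (e / 2)"
    proof -
      have "2 * R / e < real n" using n0 n by linarith
      then show ?thesis using e by (simp add: field_simps)
    qed
    finally show ?thesis using npos by (simp add: divide_right_mono field_simps)
  qed
  then show "\<exists>no. \<forall>n\<ge>no. norm ((1 / real n) *\<^sub>R (\<Sum>k<n. f k) - l) < e" by blast
qed

context finite_range_walk
begin

lemma prob_cylinder:
  assumes Q: "walk_law p Q" and z: "z \<in> bounded_paths L 0 n"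
  shows "measure Q {\<omega> \<in> space Q. \<forall>i\<le>n. \<omega> i = z ! i} = hist_weight p [0] n z"
proof -
  note b = bounded_paths_props[OF z]
  have z0: "z ! 0 = 0" using b by (cases z) auto
  have "measure Q {\<omega> \<in> space Q. \<forall>i\<le>n. \<omega> i = z ! i} =
      (\<Prod>i<n. pmf (p (map ((!) z) [0..<Suc i])) (z ! Suc i))"
    using Q z0 unfolding walk_law_def by blast
  also have "\<dots> = hist_weight p [0] n z"
    unfolding hist_weight_def
  proof (rule prod.cong[OF refl])
    fix i assume i: "i \<in> {..<n}"
    have "map ((!) z) [0..<Suc i] = take (Suc i) z"
      using b i by (intro nth_equalityI) (auto simp del: upt_Suc)
    moreover have "[0] \<circ>\<^sub>p take (Suc i) z = take (Suc i) z"
      using b by (cases z) (auto simp: path_concat_def)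
    ultimately show "pmf (p (map ((!) z) [0..<Suc i])) (z ! Suc i) =
        pmf (p ([0] \<circ>\<^sub>p take (i + 1) z)) (z ! (i + 1))" by simp
  qed
  finally show ?thesis .
qed

text \<open>The cylinders of the paths with bounded steps are disjoint and have total probability \<open>1\<close>, so
  the mean can be written as a finite sum over them. On the cylinders where \<open>\<omega>\<^sub>n / n\<close> is within \<open>e\<close>
  of \<open>\<theta>\<close> the deviation is at most \<open>e\<close>; on the others it is at most \<open>\<bar>L\<bar> + norm \<theta>\<close>.\<close>

lemma norm_mean_pos_deviation:
  assumes Q: "walk_law p Q" and n: "n > 0" and e: "e \<ge> 0"
  shows "norm ((1 / real n) *\<^sub>R mean_pos n [0] - \<theta>) \<le>
    e + (\<bar>L\<bar> + norm \<theta>) *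
      measure Q {\<omega> \<in> space Q. norm ((1 / real n) *\<^sub>R rvec (\<omega> n) - \<theta>) > e}"
proof -
  interpret prob_space Q using Q by (simp add: walk_law_def)
  let ?P = "bounded_paths L 0 n :: 'd path set"
  let ?w = "hist_weight p [0] n"
  define dev where "dev x = (1 / real n) *\<^sub>R rvec x - \<theta>" for x :: "'d site"
  define cyl where "cyl z = {\<omega> \<in> space Q. \<forall>i\<le>n. \<omega> i = z ! i}" for z :: "'d path"
  define bad where "bad = {z \<in> ?P. norm (dev (last z)) > e}"
  have w: "?w z = prob (cyl z)" if "z \<in> ?P" for z
    using prob_cylinder[OF Q that] by (simp add: cyl_def)
  have sets_Q: "sets Q = sets (PiM UNIV (\<lambda>_. count_space UNIV))"
    using Q by (simp add: walk_law_def)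
  have meas[measurable]: "(\<lambda>\<omega>. \<omega> i) \<in> measurable Q (count_space UNIV)" for i
    unfolding measurable_cong_sets[OF sets_Q refl] by (rule measurable_component_singleton) simp
  have cyl_sets: "cyl z \<in> events" for z unfolding cyl_def by measurable
  have dev_sets: "{\<omega> \<in> space Q. norm (dev (\<omega> n)) > e} \<in> events" by measurable
  have last_nth: "last z = z ! n" if "z \<in> ?P" for z
    using bounded_paths_props[OF that] by (simp add: last_conv_nth)
  have mean: "mean_pos n [0] = (\<Sum>z\<in>?P. ?w z *\<^sub>R rvec (last z))"
  proof -
    have "mean_pos n [0] = (\<Sum>z\<in>?P. ?w z *\<^sub>R rvec (last ([0] \<circ>\<^sub>p z)))"
      using sum_hist_weight_mean_pos[of "[0]" n 0] by simp
    also have "\<dots> = (\<Sum>z\<in>?P. ?w z *\<^sub>R rvec (last z))"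
      by (rule sum.cong) (auto simp: last_path_concat bounded_paths_props)
    finally show ?thesis .
  qed
  have one: "(\<Sum>z\<in>?P. ?w z) = 1" using sum_hist_weight[of "[0]" n] by simp
  have "(1 / real n) *\<^sub>R mean_pos n [0] - \<theta> =
      (1 / real n) *\<^sub>R (\<Sum>z\<in>?P. ?w z *\<^sub>R rvec (last z)) - (\<Sum>z\<in>?P. ?w z) *\<^sub>R \<theta>"
    by (simp add: mean one)
  also have "\<dots> = (\<Sum>z\<in>?P. ?w z *\<^sub>R dev (last z))"
    by (simp add: dev_def scaleR_sum_right scaleR_left.sum scaleR_diff_right sum_subtractf mult.commute)
  also have "norm \<dots> \<le> (\<Sum>z\<in>?P. norm (?w z *\<^sub>R dev (last z)))" by (rule norm_sum)
  also have "\<dots> \<le> (\<Sum>z\<in>?P. ?w z * e + (if z \<in> bad then ?w z * (\<bar>L\<bar> + norm \<theta>) else 0))"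
  proof (rule sum_mono)
    fix z assume z: "z \<in> ?P"
    have w0: "?w z \<ge> 0" by (simp add: w[OF z])
    have "norm (rvec (last z)) \<le> real n * L"
      using norm_last_bounded_path_le[OF z] by (simp add: rvec_def zero_vec_def[symmetric])
    also have "\<dots> \<le> real n * \<bar>L\<bar>" by (simp add: mult_left_mono)
    finally have "norm ((1 / real n) *\<^sub>R rvec (last z)) \<le> \<bar>L\<bar>"
      using n by (simp add: field_simps)
    then have d: "norm (dev (last z)) \<le> \<bar>L\<bar> + norm \<theta>"
      unfolding dev_def using norm_triangle_ineq4[of "(1 / real n) *\<^sub>R rvec (last z)" \<theta>] by linarith
    show "norm (?w z *\<^sub>R dev (last z)) \<le>
        ?w z * e + (if z \<in> bad then ?w z * (\<bar>L\<bar> + norm \<theta>) else 0)"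
    proof (cases "z \<in> bad")
      case True
      have "?w z * norm (dev (last z)) \<le> ?w z * (\<bar>L\<bar> + norm \<theta>)" by (rule mult_left_mono[OF d w0])
      moreover have "0 \<le> ?w z * e" using w0 e by simp
      ultimately show ?thesis using True w0 by simp
    next
      case False
      then have "norm (dev (last z)) \<le> e" using z by (simp add: bad_def)
      then show ?thesis using False w0 by (simp add: mult_left_mono)
    qed
  qed
  also have "\<dots> = e + (\<Sum>z\<in>bad. ?w z) * (\<bar>L\<bar> + norm \<theta>)"
  proof -
    have "?P \<inter> bad = bad" by (auto simp: bad_def)
    then show ?thesis
      by (simp add: sum.distrib sum_distrib_right[symmetric] one sum.inter_restrict[symmetric]
          finite_bounded_paths)
  qed
  also have "(\<Sum>z\<in>bad. ?w z) = (\<Sum>z\<in>bad. prob (cyl z))"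
    by (rule sum.cong) (auto simp: bad_def w)
  also have "\<dots> = prob (\<Union>z\<in>bad. cyl z)"
  proof (rule finite_measure_finite_Union[symmetric])
    show "finite bad" by (simp add: bad_def finite_bounded_paths)
    show "disjoint_family_on cyl bad"
    proof (unfold disjoint_family_on_def, intro ballI impI, rule ccontr)
      fix x z assume x: "x \<in> bad" and z: "z \<in> bad" and "x \<noteq> z" and "cyl x \<inter> cyl z \<noteq> {}"
      then obtain \<omega> where "\<omega> \<in> cyl x" "\<omega> \<in> cyl z" by blast
      then have "x ! i = z ! i" if "i \<le> n" for i using that by (auto simp: cyl_def)
      moreover have "length x = Suc n" "length z = Suc n"
        using x z by (auto simp: bad_def bounded_paths_props)
      ultimately have "x = z" by (auto intro: nth_equalityI)
      with \<open>x \<noteq> z\<close> show False ..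
    qed
  qed (auto simp: cyl_sets)
  also have "\<dots> \<le> prob {\<omega> \<in> space Q. norm (dev (\<omega> n)) > e}"
    by (rule finite_measure_mono[OF _ dev_sets]) (auto simp: bad_def cyl_def last_nth)
  finally show ?thesis
    by (simp add: dev_def mult.commute mult_right_mono)
qed

text \<open>Convergence in probability of a bounded sequence implies convergence of the means.\<close>

lemma mean_pos_over_n_tendsto:
  assumes Q: "walk_law p Q"
    and lim: "tendsto_in_probability Q (\<lambda>n \<omega>. (1 / real n) *\<^sub>R rvec (\<omega> n)) \<theta>"
  shows "(\<lambda>n. (1 / real n) *\<^sub>R mean_pos n [0]) \<longlonglongrightarrow> \<theta>"
proof (rule LIMSEQ_I)
  fix e :: real assume e: "e > 0"
  let ?q = "\<lambda>n. measure Q {\<omega> \<in> space Q. norm ((1 / real n) *\<^sub>R rvec (\<omega> n) - \<theta>) > e / 2}"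
  have "e / 2 > 0" using e by simp
  then have "?q \<longlonglongrightarrow> 0" using lim unfolding tendsto_in_probability_def by blast
  then have "(\<lambda>n. e / 2 + (\<bar>L\<bar> + norm \<theta>) * ?q n) \<longlonglongrightarrow> e / 2 + (\<bar>L\<bar> + norm \<theta>) * 0"
    by (intro tendsto_intros)
  then have "eventually (\<lambda>n. e / 2 + (\<bar>L\<bar> + norm \<theta>) * ?q n < e) sequentially"
    using e by (intro order_tendstoD(2)[where y = "e / 2"]) auto
  then have "eventually (\<lambda>n. norm ((1 / real n) *\<^sub>R mean_pos n [0] - \<theta>) < e) sequentially"
    using eventually_gt_at_top[of 0]
  proof eventually_elim
    case (elim n)
    then show ?case using norm_mean_pos_deviation[OF Q, of n "e / 2" \<theta>] e by linarith
  qed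
  then show "\<exists>no. \<forall>n\<ge>no. norm ((1 / real n) *\<^sub>R mean_pos n [0] - \<theta>) < e"
    by (simp add: eventually_sequentially)
qed

end

theorem theorem3p1:
  fixes p :: "'d::finite kernel" and L :: real
    and Q :: "(nat \<Rightarrow> 'd site) measure" and \<theta> :: "real ^ 'd"
  assumes "translation_invariant p"
    and "finite_range p L"
    and "walk_law p Q"
    and "convergent (\<lambda>n. \<Sum>m=2..n. first_moment (lace_pi p m))"
    and "tendsto_in_probability Q (\<lambda>n \<omega>. (1 / real n) *\<^sub>R rvec (\<omega> n)) \<theta>"
  shows "\<theta> = first_moment (step_prob p) + (\<Sum>m. first_moment (lace_pi p (m + 2)))"
proof -
  interpret finite_range_walk p L by unfold_locales fact+
  define f where "f m = first_moment (lace_pi p m)" for m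
  define a where "a n = mean_pos n [0]" for n
  obtain v where "(\<lambda>n. \<Sum>m=2..n. f m) \<longlonglongrightarrow> v"
    using assms(4) by (auto simp: convergent_def f_def)
  then have v: "(\<lambda>n. \<Sum>m=2..Suc n. f m) \<longlonglongrightarrow> v" by (rule LIMSEQ_Suc)
  have "(\<Sum>m<n. f (m + 2)) = (\<Sum>m=2..Suc n. f m)" for n by (induction n) simp_all
  with v have "(\<lambda>m. f (m + 2)) sums v" by (simp add: sums_def)
  then have v_eq: "v = (\<Sum>m. f (m + 2))" by (rule sums_unique)
  have "(\<lambda>n. a (Suc n) - a n) \<longlonglongrightarrow> first_moment (step_prob p) + v"
    unfolding a_def mean_pos_increment f_def[symmetric] by (intro tendsto_add tendsto_const v)
  then have "(\<lambda>n. (1 / real n) *\<^sub>R (\<Sum>k<n. a (Suc k) - a k)) \<longlonglongrightarrow> first_moment (step_prob p) + v"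
    by (rule cesaro_mean_tendsto)
  moreover have "(\<Sum>k<n. a (Suc k) - a k) = a n" for n
    unfolding sum_lessThan_telescope by (simp add: a_def rvec_def vec_eq_iff)
  ultimately have "(\<lambda>n. (1 / real n) *\<^sub>R a n) \<longlonglongrightarrow> first_moment (step_prob p) + v" by simp
  moreover have "(\<lambda>n. (1 / real n) *\<^sub>R a n) \<longlonglongrightarrow> \<theta>"
    unfolding a_def using assms(3,5) by (rule mean_pos_over_n_tendsto)
  ultimately have "\<theta> = first_moment (step_prob p) + v" by (rule LIMSEQ_unique[rotated])
  then show ?thesis by (simp add: v_eq f_def)
qed

end
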